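(* Every (finite, simple, connected) fractionally Hamiltonian graph is resistance positive (RP).
   Context: All graphs are finite, simple and connected. For a nonempty proper set $S\subsetneq V(G)$, let $\partial(S):=\{uv\in E(G): |\{u,v\}\cap S|=1\}$. For an edge weighting $f:E(G)\to\mathbb R$ and $F\subseteq E(G)$, write $f(F):=\sum_{e\in F}f(e)$. A fractional Hamiltonian cycle of $G$ is an edge weighting $f:E(G)\to[0,1]$ such that $f(E(G))=|V(G)|$ and $f(\partial(S))\ge 2$ for every nonempty proper set $S\subsetneq V(G)$. A graph is fractionally Hamiltonian if it has a fractional Hamiltonian cycle. Resistance curvature: let $G=(V,E)$ be a finite simple connected graph, $\mathcal T(G)$ its set of spanning trees, and $c=(c_e)_{e\in E}$ positive edge weights. The relative resistance of an edge $e$ is $$r_e(c):=\frac{\sum_{T\in\mathcal T(G),\, e\in T}\prod_{h\in T}c_h}{\sum_{T\in\mathcal T(G)}\prod_{h\in T}c_h}$$ (equivalently $c_e$ times the effective resistance between the ends of $e$), and the resistance curvature of a vertex $v$ is $p_v(c):=1-\frac12\sum_{e\ni v}r_e(c)$. $G$ is resistance positive (RP) if there exist positive edge weights $c$ with $p_v(c)>0$ for every $v\in V$. *)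

theory Defs
  imports Complex_Main
begin

text \<open>Undirected edges are two-element vertex sets. Weightings are total functions on
  \<open>'a set\<close>; only their values on the edge set \<open>E\<close> matter.\<close>

definition adj_rel :: "'a set set \<Rightarrow> ('a \<times> 'a) set" where
  "adj_rel E = {(u, v). {u, v} \<in> E}"

definition connected_graph :: "'a set \<Rightarrow> 'a set set \<Rightarrow> bool" where
  "connected_graph V E \<longleftrightarrow> V \<noteq> {} \<and> (\<forall>u\<in>V. \<forall>v\<in>V. (u, v) \<in> (adj_rel E)\<^sup>*)"

locale fin_simple_connected_graph =
  fixes V :: "'a set" and E :: "'a set set"
  assumes finite_V: "finite V"
    and edges: "\<And>e. e \<in> E \<Longrightarrow> e \<subseteq> V \<and> card e = 2"
    and connected: "connected_graph V E"

text \<open>A cycle is given by the cyclic sequence of its distinct vertices.\<close>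

definition graph_cycle :: "'a set set \<Rightarrow> 'a list \<Rightarrow> bool" where
  "graph_cycle E vs \<longleftrightarrow> length vs \<ge> 3 \<and> distinct vs \<and>
     (\<forall>i<length vs. {vs ! i, vs ! (Suc i mod length vs)} \<in> E)"

text \<open>A spanning tree is represented by its edge set.\<close>

definition spanning_trees :: "'a set \<Rightarrow> 'a set set \<Rightarrow> 'a set set set" where
  "spanning_trees V E = {T. T \<subseteq> E \<and> connected_graph V T \<and> (\<nexists>vs. graph_cycle T vs)}"

definition edge_boundary :: "'a set set \<Rightarrow> 'a set \<Rightarrow> 'a set set" where
  "edge_boundary E S = {e \<in> E. card (e \<inter> S) = 1}"

definition fractional_hamiltonian_cycle ::
  "'a set \<Rightarrow> 'a set set \<Rightarrow> ('a set \<Rightarrow> real) \<Rightarrow> bool" where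
  "fractional_hamiltonian_cycle V E f \<longleftrightarrow>
     (\<forall>e\<in>E. 0 \<le> f e \<and> f e \<le> 1) \<and>
     (\<Sum>e\<in>E. f e) = real (card V) \<and>
     (\<forall>S. S \<noteq> {} \<and> S \<subset> V \<longrightarrow> (\<Sum>e\<in>edge_boundary E S. f e) \<ge> 2)"

definition fractionally_hamiltonian :: "'a set \<Rightarrow> 'a set set \<Rightarrow> bool" where
  "fractionally_hamiltonian V E \<longleftrightarrow> (\<exists>f. fractional_hamiltonian_cycle V E f)"

definition relative_resistance ::
  "'a set \<Rightarrow> 'a set set \<Rightarrow> ('a set \<Rightarrow> real) \<Rightarrow> 'a set \<Rightarrow> real" where
  "relative_resistance V E c e =
     (\<Sum>T\<in>{T \<in> spanning_trees V E. e \<in> T}. \<Prod>h\<in>T. c h) /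
     (\<Sum>T\<in>spanning_trees V E. \<Prod>h\<in>T. c h)"

definition resistance_curvature ::
  "'a set \<Rightarrow> 'a set set \<Rightarrow> ('a set \<Rightarrow> real) \<Rightarrow> 'a \<Rightarrow> real" where
  "resistance_curvature V E c v =
     1 - 1 / 2 * (\<Sum>e\<in>{e \<in> E. v \<in> e}. relative_resistance V E c e)"

definition resistance_positive :: "'a set \<Rightarrow> 'a set set \<Rightarrow> bool" where
  "resistance_positive V E \<longleftrightarrow>
     (\<exists>c. (\<forall>e\<in>E. c e > 0) \<and> (\<forall>v\<in>V. resistance_curvature V E c v > 0))"

end

theory Submission
  imports Defs "HOL-Library.Disjoint_Sets"
begin

text \<open>Let \<open>n\<close> be the number of vertices and \<open>f\<close> a fractional Hamiltonian cycle. The cut conditions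
  force every \<open>f\<close>-degree to be 2, so \<open>x = (n - 1) / n * f\<close> lies in the spanning tree polytope and all
  its degrees are \<open>2 - 2 / n\<close>. It remains to find weights \<open>c\<close> whose relative resistances exceed \<open>x\<close> by
  an arbitrarily small amount at most. With \<open>c = exp w\<close> and \<open>Z\<close> the weighted number of spanning
  trees, the function \<open>ln Z(exp w) - \<langle>w, x\<rangle>\<close> has the partial derivatives \<open>r\<^sub>e - x\<^sub>e\<close>. It is
  nonnegative, because the greedy algorithm finds a spanning tree of weight at least \<open>\<langle>w, x\<rangle>\<close>, so
  its derivatives are arbitrarily small at a suitable near-minimiser.\<close>

section \<open>Forests, component partitions and one step of Kruskal's algorithm\<close>

text \<open>The state of Kruskal's algorithm after the edges \<open>P\<close>: the chosen forest \<open>F\<close> and the partition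
  of \<open>V\<close> into its components.\<close>

definition forest_blocks :: "'a set \<Rightarrow> 'a set set \<Rightarrow> 'a set set \<Rightarrow> 'a set set \<Rightarrow> bool" where
  "forest_blocks V P F \<P> \<longleftrightarrow>
     partition_on V \<P> \<and> F \<subseteq> P \<and> (\<forall>e\<in>P. \<exists>B\<in>\<P>. e \<subseteq> B) \<and>
     (\<forall>B\<in>\<P>. \<forall>u\<in>B. \<forall>v\<in>B. (u, v) \<in> (adj_rel F)\<^sup>*) \<and>
     card F + card \<P> = card V \<and> (\<nexists>vs. graph_cycle F vs)"

lemma adj_rel_mono: "E \<subseteq> F \<Longrightarrow> adj_rel E \<subseteq> adj_rel F"
  by (auto simp: adj_rel_def)

text \<open>If \<open>i\<close> and \<open>j\<close> differed, each would be the cyclic successor of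
  the other and the length would divide 2. Used to see that a cycle passes through a given edge only
  once.\<close>

lemma cycle_edge_eq_imp_index_eq:
  assumes "length vs \<ge> 3" "distinct vs" "i < length vs" "j < length vs"
    and "{vs ! i, vs ! (Suc i mod length vs)} = {vs ! j, vs ! (Suc j mod length vs)}"
  shows "i = j"
proof (rule ccontr)
  assume "i \<noteq> j"
  let ?n = "length vs"
  have n: "Suc i mod ?n < ?n" "Suc j mod ?n < ?n"
    using assms(1) by (auto intro!: mod_less_divisor)
  have "vs ! i \<noteq> vs ! j"
    using \<open>i \<noteq> j\<close> assms by (simp add: nth_eq_iff_index_eq)
  then have "vs ! i = vs ! (Suc j mod ?n)" "vs ! j = vs ! (Suc i mod ?n)"
    using assms(5) by (auto simp: doubleton_eq_iff)
  then have "i = Suc j mod ?n" "j = Suc i mod ?n"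
    using assms n by (simp_all add: nth_eq_iff_index_eq)
  then have *: "i = Suc (Suc i) mod ?n" by (metis mod_Suc_eq)
  consider "Suc (Suc i) < ?n" | "Suc (Suc i) = ?n" | "Suc (Suc i) = Suc ?n"
    using assms(3) by linarith
  then show False
    using * assms(1) by cases (simp_all add: mod_Suc)
qed

lemma forest_blocks_same_block:
  assumes "forest_blocks V P F \<P>" "{u, v} \<in> P" "B \<in> \<P>" "u \<in> B"
  shows "v \<in> B"
proof -
  obtain C where C: "C \<in> \<P>" "{u, v} \<subseteq> C"
    using assms(1,2) unfolding forest_blocks_def by blast
  have "disjoint \<P>"
    using assms(1) by (simp add: forest_blocks_def partition_on_def)
  then have "B = C"
    using C assms(3,4) by (auto simp: disjoint_def)
  then show ?thesis using C by simp
qed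

text \<open>A cycle in the enlarged forest must use the new edge, and only once. The rest of the
  cycle is a walk along edges of \<open>P\<close>, which never leaves a block, so \<open>u\<close>
  and \<open>v\<close> would share one.\<close>

lemma forest_blocks_joining_edge_acyclic:
  assumes FB: "forest_blocks V P F \<P>"
    and B: "B \<in> \<P>" "u \<in> B" and C: "C \<in> \<P>" "v \<in> C" and "B \<noteq> C"
  shows "\<not> graph_cycle (insert {u, v} F) vs"
proof
  assume cyc: "graph_cycle (insert {u, v} F) vs"
  let ?n = "length vs"
  have n: "?n \<ge> 3" "distinct vs"
    and ed: "\<And>i. i < ?n \<Longrightarrow> {vs ! i, vs ! (Suc i mod ?n)} \<in> insert {u, v} F"
    using cyc by (auto simp: graph_cycle_def)
  have "\<not> graph_cycle F vs" using FB by (auto simp: forest_blocks_def)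
  then obtain i where i: "i < ?n" "{vs ! i, vs ! (Suc i mod ?n)} \<notin> F"
    using n by (auto simp: graph_cycle_def)
  then have uv: "{vs ! i, vs ! (Suc i mod ?n)} = {u, v}" using ed by blast
  have inP: "{vs ! j, vs ! (Suc j mod ?n)} \<in> P" if "j < ?n" "j \<noteq> i" for j
  proof -
    have "{vs ! j, vs ! (Suc j mod ?n)} \<noteq> {u, v}"
      using cycle_edge_eq_imp_index_eq[OF n that(1) i(1)] that(2) uv by metis
    then show ?thesis
      using ed[OF that(1)] FB by (auto simp: forest_blocks_def)
  qed
  \<comment> \<open>The walk starts at the far end of edge number \<open>i\<close>. As long as
    \<open>k < ?n\<close> it has not come round to that edge again, so all its edges belong to
    \<open>P\<close>.\<close>
  have walk: "vs ! ((Suc i + k) mod ?n) \<in> C"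
    if "C \<in> \<P>" "vs ! (Suc i mod ?n) \<in> C" "k < ?n" for k C
    using that(3)
  proof (induction k)
    case 0
    then show ?case using that by simp
  next
    case (Suc k)
    have "(Suc i + k) mod ?n \<noteq> i"
    proof
      assume "(Suc i + k) mod ?n = i"
      then have "(i + Suc k) mod ?n = i mod ?n" using i by simp
      then have "?n dvd Suc k"
        by (metis add_diff_cancel_left' le_add1 mod_eq_dvd_iff_nat)
      then show False using Suc.prems by (auto dest: dvd_imp_le)
    qed
    moreover have "(Suc i + k) mod ?n < ?n"
      using n(1) by (intro mod_less_divisor) linarith
    ultimately have "{vs ! ((Suc i + k) mod ?n), vs ! (Suc ((Suc i + k) mod ?n) mod ?n)} \<in> P"
      by (intro inP)
    moreover have "Suc ((Suc i + k) mod ?n) mod ?n = (Suc i + Suc k) mod ?n"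
      by (simp add: mod_Suc_eq)
    ultimately show ?case
      using forest_blocks_same_block[OF FB _ that(1)] Suc by simp
  qed
  \<comment> \<open>With \<open>?n - 1\<close> steps, the largest number that \<open>walk\<close>
    allows, index \<open>i\<close> is reached: the other end of the joining edge.\<close>
  have endpoint: "vs ! i \<in> C" if "C \<in> \<P>" "vs ! (Suc i mod ?n) \<in> C" for C
  proof -
    have "(Suc i + (?n - 1)) mod ?n = (i + ?n) mod ?n"
      using n(1) by (intro arg_cong[where f = "\<lambda>k. k mod ?n"]) linarith
    then have "(Suc i + (?n - 1)) mod ?n = i" using i by simp
    moreover have "?n - 1 < ?n" using n by linarith
    ultimately show ?thesis using walk[OF that, of "?n - 1"] by simp
  qed
  have "u \<in> C \<or> v \<in> B"
    using uv endpoint[OF C(1)] endpoint[OF B(1)] B C by (auto simp: doubleton_eq_iff)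
  then show False
    using B C \<open>B \<noteq> C\<close> FB by (auto simp: forest_blocks_def partition_on_def disjoint_def)
qed

lemma forest_blocks_empty:
  assumes "finite V"
  shows "forest_blocks V {} {} ((\<lambda>v. {v}) ` V)"
proof -
  have "card ((\<lambda>v. {v}) ` V) = card V" by (simp add: card_image)
  moreover have "\<not> graph_cycle {} vs" for vs :: "'a list"
    by (cases vs) (auto simp: graph_cycle_def)
  ultimately show ?thesis
    by (auto simp: forest_blocks_def partition_on_def disjoint_def)
qed

text \<open>An edge inside a block is skipped; an edge between two blocks is taken and merges them.
  Taking it adds one edge and removes one block, which preserves
  \<open>card F + card \<P>\<close>.\<close>

lemma forest_blocks_insert:
  assumes fin: "finite V" "finite P" and FB: "forest_blocks V P F \<P>"
    and e: "e \<subseteq> V" "card e = 2"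
  obtains F' \<P>' where "forest_blocks V (insert e P) F' \<P>'"
    and "F' = F \<or> F' = insert e F \<and> e \<notin> F"
proof -
  obtain u v where uv: "e = {u, v}" "u \<noteq> v"
    using e(2) by (auto simp: card_2_iff)
  have part: "\<Union>\<P> = V" "{} \<notin> \<P>"
    and disj: "\<And>B C. B \<in> \<P> \<Longrightarrow> C \<in> \<P> \<Longrightarrow> B \<noteq> C \<Longrightarrow> B \<inter> C = {}"
    using FB by (auto simp: forest_blocks_def partition_on_def disjoint_def)
  have FP: "F \<subseteq> P" and PB: "\<And>e. e \<in> P \<Longrightarrow> \<exists>B\<in>\<P>. e \<subseteq> B"
    and conn: "\<And>B u v. B \<in> \<P> \<Longrightarrow> u \<in> B \<Longrightarrow> v \<in> B \<Longrightarrow> (u, v) \<in> (adj_rel F)\<^sup>*"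
    and cd: "card F + card \<P> = card V"
    using FB by (auto simp: forest_blocks_def)
  obtain B C where B: "B \<in> \<P>" "u \<in> B" and C: "C \<in> \<P>" "v \<in> C"
    using e(1) uv part by blast
  show ?thesis
  proof (cases "B = C")
    case True
    then have "forest_blocks V (insert e P) F \<P>"
      using FB B C uv by (auto simp: forest_blocks_def)
    then show ?thesis using that by blast
  next
    case False
    let ?F = "insert e F" and ?P = "insert (B \<union> C) (\<P> - {B, C})"
    have vB: "v \<notin> B" using False B C disj by blast
    have eF: "e \<notin> F"
      using forest_blocks_same_block[OF FB, of u v B] FP B vB uv by auto
    have finP: "finite \<P>" using fin part by (auto intro: finite_UnionD)
    \<comment> \<open>A block other than \<open>B\<close> is disjoint from \<open>B\<close>, so the
      union is a new block and the number of blocks drops by exactly one.\<close>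
    have BC: "B \<union> C \<notin> \<P> - {B, C}"
      using disj[OF _ B(1)] B by blast
    have "card \<P> \<ge> card {B, C}" using B C finP by (intro card_mono) auto
    then have "card ?P = card \<P> - 1"
      using BC finP B C False by (simp add: card_Diff_subset)
    moreover have "card \<P> > 0" using finP B by (auto simp: card_gt_0_iff)
    moreover have "finite F" using FP fin finite_subset by blast
    ultimately have 1: "card ?F + card ?P = card V" using cd eF by simp
    have 2: "partition_on V ?P"
      unfolding partition_on_def
    proof (intro conjI)
      show "\<Union> ?P = V" using part B C by auto
      show "{} \<notin> ?P" using part B by auto
      show "disjoint ?P"
        using disj[OF _ B(1)] disj[OF _ C(1)] disj unfolding disjoint_def by auto
    qed
    have 3: "\<exists>D\<in>?P. h \<subseteq> D" if h: "h \<in> insert e P" for h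
    proof (cases "h = e")
      case True
      then show ?thesis using B C uv by (intro bexI[of _ "B \<union> C"]) auto
    next
      case False
      then obtain D where "D \<in> \<P>" "h \<subseteq> D" using PB h by blast
      then show ?thesis 
        by (intro bexI[of _ "if D = B \<or> D = C then B \<union> C else D"]) auto
    qed
    have mono: "(adj_rel F)\<^sup>* \<subseteq> (adj_rel ?F)\<^sup>*"
      by (intro rtrancl_mono adj_rel_mono) auto
    have uvF: "(u, v) \<in> (adj_rel ?F)\<^sup>*" "(v, u) \<in> (adj_rel ?F)\<^sup>*"
      using uv by (auto simp: adj_rel_def insert_commute)
    have 4: "(a, b) \<in> (adj_rel ?F)\<^sup>*" if D: "D \<in> ?P" "a \<in> D" "b \<in> D" for D a b
    proof -
      have conn': "(a, b) \<in> (adj_rel ?F)\<^sup>*" if "D \<in> \<P>" "a \<in> D" "b \<in> D" for D a b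
        using conn[OF that] mono by blast
      have "(a, b) \<in> (adj_rel ?F)\<^sup>*" if "a \<in> B" "b \<in> C" for a b
        using conn'[OF B(1) that(1) B(2)] uvF(1) conn'[OF C(1) C(2) that(2)]
        by (meson rtrancl_trans)
      moreover have "(a, b) \<in> (adj_rel ?F)\<^sup>*" if "a \<in> C" "b \<in> B" for a b
        using conn'[OF C(1) that(1) C(2)] uvF(2) conn'[OF B(1) B(2) that(2)]
        by (meson rtrancl_trans)
      ultimately show ?thesis using D conn' B(1) C(1) by blast
    qed
    have 5: "\<not> graph_cycle ?F vs" for vs
      using forest_blocks_joining_edge_acyclic[OF FB B C False] uv by simp
    have "forest_blocks V (insert e P) ?F ?P"
      unfolding forest_blocks_def
    proof (intro conjI ballI)
      show "?F \<subseteq> insert e P" using FP by auto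
      show "\<nexists>vs. graph_cycle ?F vs" using 5 by simp
    qed (rule 2, erule 3, erule (2) 4, rule 1)
    then show ?thesis by (rule that) (simp add: eF)
  qed
qed

text \<open>No edge of \<open>E\<close> leaves a block, so connectedness makes every block equal to
  \<open>V\<close>. Hence the forest left after processing all edges is a spanning tree.\<close>

lemma forest_blocks_connected:
  assumes FB: "forest_blocks V E F \<P>" and conn: "connected_graph V E"
  shows "\<P> = {V}" and "connected_graph V F"
proof -
  have part: "\<Union>\<P> = V" "{} \<notin> \<P>"
    using FB by (auto simp: forest_blocks_def partition_on_def)
  have "B = V" if B: "B \<in> \<P>" for B
  proof
    show "B \<subseteq> V" using part B by blast
    obtain u where u: "u \<in> B" using B part by (metis ex_in_conv)
    show "V \<subseteq> B"
    proof
      fix v assume "v \<in> V"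
      then have "(u, v) \<in> (adj_rel E)\<^sup>*"
        using conn u \<open>B \<subseteq> V\<close> by (auto simp: connected_graph_def)
      then show "v \<in> B"
      proof (induction rule: rtrancl_induct)
        case base
        then show ?case by (rule u)
      next
        case (step y z)
        then show ?case
          using forest_blocks_same_block[OF FB _ B] by (auto simp: adj_rel_def)
      qed
    qed
  qed
  moreover have "\<P> \<noteq> {}" using part conn by (auto simp: connected_graph_def)
  ultimately show V: "\<P> = {V}" by blast
  show "connected_graph V F"
    using FB conn V by (auto simp: forest_blocks_def connected_graph_def)
qed

section \<open>Greedy trees and the spanning tree polytope\<close>

context fin_simple_connected_graph
begin

lemma finite_E: "finite E"
  using finite_V edges by (intro finite_subset[of E "Pow V"]) auto

lemma finite_spanning_trees: "finite (spanning_trees V E)"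
  by (rule finite_subset[of _ "Pow E"]) (auto simp: spanning_trees_def finite_E)

text \<open>Every edge of \<open>P\<close> lies in a block, and \<open>xS\<close> bounds block
  \<open>B\<close> by \<open>card B - 1\<close>; these bounds add up to
  \<open>card V - card \<P> = card F\<close>, the rank of \<open>P\<close> in the graphic
  matroid.\<close>

lemma sum_le_card_forest:
  fixes x :: "'a set \<Rightarrow> real"
  assumes x0: "\<And>e. e \<in> E \<Longrightarrow> 0 \<le> x e"
    and xS: "\<And>S. S \<noteq> {} \<Longrightarrow> S \<subseteq> V \<Longrightarrow> (\<Sum>e\<in>{e \<in> E. e \<subseteq> S}. x e) \<le> real (card S) - 1"
    and FB: "forest_blocks V P F \<P>" and P: "P \<subseteq> E"
  shows "(\<Sum>e\<in>P. x e) \<le> real (card F)"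
proof -
  have part: "\<Union>\<P> = V" "{} \<notin> \<P>"
    and disj: "\<And>B C. B \<in> \<P> \<Longrightarrow> C \<in> \<P> \<Longrightarrow> B \<noteq> C \<Longrightarrow> B \<inter> C = {}"
    using FB by (auto simp: forest_blocks_def partition_on_def disjoint_def)
  have finP: "finite \<P>" using finite_V part by (auto intro: finite_UnionD)
  have finB: "finite B" if "B \<in> \<P>" for B
    using that part finite_V by (metis Sup_upper finite_subset)
  have "(\<Sum>e\<in>P. x e) \<le> (\<Sum>e\<in>(\<Union>B\<in>\<P>. {e \<in> E. e \<subseteq> B}). x e)"
  proof (rule sum_mono2)
    show "finite (\<Union>B\<in>\<P>. {e \<in> E. e \<subseteq> B})" using finP finite_E by auto
    show "P \<subseteq> (\<Union>B\<in>\<P>. {e \<in> E. e \<subseteq> B})"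
    proof
      fix e assume "e \<in> P"
      then have "e \<in> E" and "\<exists>B\<in>\<P>. e \<subseteq> B"
        using P FB by (auto simp: forest_blocks_def)
      then show "e \<in> (\<Union>B\<in>\<P>. {e \<in> E. e \<subseteq> B})" by simp
    qed
  qed (use x0 in auto)
  also have "\<dots> = (\<Sum>B\<in>\<P>. \<Sum>e\<in>{e \<in> E. e \<subseteq> B}. x e)"
  proof (rule sum.UNION_disjoint)
    have "{e \<in> E. e \<subseteq> B} \<inter> {e \<in> E. e \<subseteq> C} = {}"
      if BC: "B \<in> \<P>" "C \<in> \<P>" "B \<noteq> C" for B C
    proof -
      have False if "e \<in> E" "e \<subseteq> B" "e \<subseteq> C" for e
      proof -
        have "e \<subseteq> {}" using disj[OF BC] that by blast
        then show False using edges[OF \<open>e \<in> E\<close>] by simp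
      qed
      then show ?thesis by blast
    qed
    then show "\<forall>B\<in>\<P>. \<forall>C\<in>\<P>. B \<noteq> C \<longrightarrow> {e \<in> E. e \<subseteq> B} \<inter> {e \<in> E. e \<subseteq> C} = {}"
      by blast
  qed (use finP finite_E in auto)
  also have "\<dots> \<le> (\<Sum>B\<in>\<P>. real (card B) - 1)"
    using part by (intro sum_mono xS) auto
  also have "\<dots> = real (\<Sum>B\<in>\<P>. card B) - real (card \<P>)"
    by (simp add: sum_subtractf)
  also have "(\<Sum>B\<in>\<P>. card B) = card V"
    using part disj finB by (subst part(1)[symmetric], subst card_Union_disjoint)
      (auto simp: pairwise_def disjnt_def)
  also have "real (card V) - real (card \<P>) = real (card F)"
    using FB by (auto simp: forest_blocks_def)
  finally show ?thesis .
qed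

text \<open>Kruskal's algorithm processes the edges by decreasing weight. The statement for all lower
  bounds \<open>\<mu>\<close> is Abel summation over the weight levels, arranged as an induction invariant.\<close>

lemma greedy_forest:
  fixes x w :: "'a set \<Rightarrow> real"
  assumes x0: "\<And>e. e \<in> E \<Longrightarrow> 0 \<le> x e"
    and xS: "\<And>S. S \<noteq> {} \<Longrightarrow> S \<subseteq> V \<Longrightarrow> (\<Sum>e\<in>{e \<in> E. e \<subseteq> S}. x e) \<le> real (card S) - 1"
    and P: "P \<subseteq> E"
  shows "\<exists>F \<P>. forest_blocks V P F \<P> \<and>
    (\<forall>\<mu>. (\<forall>e\<in>P. \<mu> \<le> w e) \<longrightarrow> (\<Sum>e\<in>P. (w e - \<mu>) * x e) \<le> (\<Sum>e\<in>F. w e - \<mu>))"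
proof -
  have "finite P" using P finite_E finite_subset by blast
  then show ?thesis using P
  \<comment> \<open>Ranking by \<open>- w\<close> makes the inserted edge one of least weight so
    far.\<close>
  proof (induction P rule: finite_ranking_induct[where f = "\<lambda>e. - w e"])
    case empty
    then show ?case using forest_blocks_empty[OF finite_V] by auto
  next
    case (insert e P)
    from insert obtain F \<P> where FB: "forest_blocks V P F \<P>"
      and IH: "\<And>\<mu>. (\<forall>e\<in>P. \<mu> \<le> w e) \<Longrightarrow> (\<Sum>e\<in>P. (w e - \<mu>) * x e) \<le> (\<Sum>e\<in>F. w e - \<mu>)"
      by auto
    have e: "e \<in> E" using insert by simp
    obtain F' \<P>' where FB': "forest_blocks V (insert e P) F' \<P>'"
      and F': "F' = F \<or> F' = insert e F \<and> e \<notin> F"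
      using forest_blocks_insert[OF finite_V insert(1) FB] edges[OF e] by metis
    have finF: "finite F"
      using FB insert(1) by (auto simp: forest_blocks_def intro: finite_subset)
    have "(\<Sum>h\<in>insert e P. (w h - \<mu>) * x h) \<le> (\<Sum>h\<in>F'. w h - \<mu>)"
      if \<mu>: "\<forall>h\<in>insert e P. \<mu> \<le> w h" for \<mu>
    proof -
      \<comment> \<open>Splitting at level \<open>w e\<close> makes the new edge vanish from the
        first sum, so the induction hypothesis applies with \<open>w e\<close> as lower bound. The
        remainder is a nonnegative multiple of the total of \<open>x\<close>, which the rank bound
        controls.\<close>
      have "(\<Sum>h\<in>insert e P. (w h - \<mu>) * x h)
          = (\<Sum>h\<in>insert e P. (w h - w e) * x h) + (w e - \<mu>) * (\<Sum>h\<in>insert e P. x h)"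
        unfolding sum_distrib_left sum.distrib[symmetric]
        by (intro sum.cong refl) (simp add: algebra_simps)
      also have "(\<Sum>h\<in>insert e P. (w h - w e) * x h) = (\<Sum>h\<in>P. (w h - w e) * x h)"
        using insert(1) by (cases "e \<in> P") (simp_all add: insert_absorb)
      also have "\<dots> \<le> (\<Sum>h\<in>F. w h - w e)"
        using insert(2) by (intro IH) auto
      also have "\<dots> = (\<Sum>h\<in>F'. w h - w e)"
        using F' finF by auto
      also have "(w e - \<mu>) * (\<Sum>h\<in>insert e P. x h) \<le> (w e - \<mu>) * real (card F')"
        using \<mu> sum_le_card_forest[OF x0 xS FB' insert.prems]
        by (intro mult_left_mono) auto
      also have "(\<Sum>h\<in>F'. w h - w e) + (w e - \<mu>) * real (card F') = (\<Sum>h\<in>F'. w h - \<mu>)"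
        by (simp add: sum_subtractf algebra_simps)
      finally show ?thesis by simp
    qed
    with FB' show ?case by blast
  qed
qed

text \<open>Edmonds' description of the spanning tree polytope, in its linear programming form. The
  lower bound \<open>\<mu>\<close> from the greedy inequality cancels, since \<open>x\<close> has
  the same total as a spanning tree has edges.\<close>

lemma spanning_tree_weight_ge:
  fixes x w :: "'a set \<Rightarrow> real"
  assumes x0: "\<And>e. e \<in> E \<Longrightarrow> 0 \<le> x e"
    and xS: "\<And>S. S \<noteq> {} \<Longrightarrow> S \<subseteq> V \<Longrightarrow> (\<Sum>e\<in>{e \<in> E. e \<subseteq> S}. x e) \<le> real (card S) - 1"
    and xE: "(\<Sum>e\<in>E. x e) = real (card V) - 1"
  obtains T where "T \<in> spanning_trees V E" and "(\<Sum>e\<in>E. w e * x e) \<le> (\<Sum>e\<in>T. w e)"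
proof -
  obtain F \<P> where FB: "forest_blocks V E F \<P>"
    and w: "\<And>\<mu>. (\<forall>e\<in>E. \<mu> \<le> w e) \<Longrightarrow> (\<Sum>e\<in>E. (w e - \<mu>) * x e) \<le> (\<Sum>e\<in>F. w e - \<mu>)"
    using greedy_forest[of x E w, OF x0 xS order_refl] by blast
  have "F \<in> spanning_trees V E"
    using forest_blocks_connected(2)[OF FB connected] FB
    by (simp add: spanning_trees_def forest_blocks_def)
  moreover have "(\<Sum>e\<in>E. w e * x e) \<le> (\<Sum>e\<in>F. w e)"
  proof -
    obtain \<mu> where "\<forall>e\<in>E. \<mu> \<le> w e"
      using finite_E by (metis Min_le finite_imageI imageI)
    from w[OF this] have "(\<Sum>e\<in>E. w e * x e) - \<mu> * (\<Sum>e\<in>E. x e) \<le> (\<Sum>e\<in>F. w e) - \<mu> * card F"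
      by (simp add: sum_subtractf sum_distrib_left algebra_simps)
    moreover have "card F + 1 = card V"
      using FB forest_blocks_connected(1)[OF FB connected] by (simp add: forest_blocks_def)
    then have "real (card F) = real (card V) - 1" by linarith
    ultimately show ?thesis using xE by simp
  qed
  ultimately show ?thesis using that by blast
qed

section \<open>Relative resistances from near-minimisers\<close>

text \<open>A tree contains \<open>e\<close> at most once, so the tree sum is affine in
  \<open>c e\<close>. This exact formula stands in for the derivative of \<open>ln Z\<close> with
  respect to \<open>w e\<close>.\<close>

lemma tree_sum_scale_edge:
  fixes c :: "'a set \<Rightarrow> real"
  assumes "(\<Sum>T\<in>spanning_trees V E. \<Prod>h\<in>T. c h) \<noteq> 0"
  shows "(\<Sum>T\<in>spanning_trees V E. \<Prod>h\<in>T. (c(e := a * c e)) h) =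
    (\<Sum>T\<in>spanning_trees V E. \<Prod>h\<in>T. c h) * (1 - (1 - a) * relative_resistance V E c e)"
proof -
  let ?\<T> = "spanning_trees V E"
  let ?Z = "\<Sum>T\<in>?\<T>. \<Prod>h\<in>T. c h"
  have scaled: "(\<Prod>h\<in>T. (c(e := a * c e)) h)
      = (\<Prod>h\<in>T. c h) - (1 - a) * (if e \<in> T then \<Prod>h\<in>T. c h else 0)"
    if "T \<in> ?\<T>" for T
  proof -
    have fin: "finite T"
      using that finite_E by (auto simp: spanning_trees_def intro: finite_subset)
    show ?thesis
    proof (cases "e \<in> T")
      case True
      have "(\<Prod>h\<in>T - {e}. (c(e := a * c e)) h) = (\<Prod>h\<in>T - {e}. c h)"
        by (intro prod.cong) auto
      then show ?thesis
        using True fin by (simp add: prod.remove[of T e] algebra_simps)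
    next
      case False
      then have "(\<Prod>h\<in>T. (c(e := a * c e)) h) = (\<Prod>h\<in>T. c h)"
        by (intro prod.cong) auto
      then show ?thesis using False by simp
    qed
  qed
  have "(\<Sum>T\<in>?\<T>. \<Prod>h\<in>T. (c(e := a * c e)) h)
      = (\<Sum>T\<in>?\<T>. \<Prod>h\<in>T. c h) - (1 - a) * (\<Sum>T\<in>{T \<in> ?\<T>. e \<in> T}. \<Prod>h\<in>T. c h)"
    using finite_spanning_trees
    by (simp only: scaled sum_subtractf sum_distrib_left[symmetric] sum.inter_filter cong: sum.cong)
  moreover have "(\<Sum>T\<in>{T \<in> ?\<T>. e \<in> T}. \<Prod>h\<in>T. c h) = ?Z * relative_resistance V E c e"
    using assms by (simp add: relative_resistance_def)
  ultimately show ?thesis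
    by (simp only: right_diff_distrib mult_1_right mult.left_commute[of ?Z "1 - a"])
qed

text \<open>Lowering one coordinate of a near-minimiser by \<open>t\<close> gains at most \<open>t\<^sup>2\<close>, which bounds \<open>r\<^sub>e\<close>. This
  avoids showing that a minimum is attained.\<close>

lemma relative_resistance_approx:
  fixes x :: "'a set \<Rightarrow> real"
  assumes x0: "\<And>e. e \<in> E \<Longrightarrow> 0 \<le> x e"
    and xS: "\<And>S. S \<noteq> {} \<Longrightarrow> S \<subseteq> V \<Longrightarrow> (\<Sum>e\<in>{e \<in> E. e \<subseteq> S}. x e) \<le> real (card S) - 1"
    and xE: "(\<Sum>e\<in>E. x e) = real (card V) - 1"
    and \<delta>: "0 < \<delta>"
  obtains c where "\<And>e. 0 < c e" and "\<And>e. e \<in> E \<Longrightarrow> relative_resistance V E c e \<le> x e + \<delta>"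
proof -
  define Z where "Z w = (\<Sum>T\<in>spanning_trees V E. \<Prod>h\<in>T. exp (w h))" for w :: "'a set \<Rightarrow> real"
  define G where "G w = ln (Z w) - (\<Sum>e\<in>E. w e * x e)" for w
  have Z_ge: "exp (\<Sum>e\<in>E. w e * x e) \<le> Z w" for w
  proof -
    obtain T where T: "T \<in> spanning_trees V E" "(\<Sum>e\<in>E. w e * x e) \<le> (\<Sum>e\<in>T. w e)"
      using spanning_tree_weight_ge[of x w, OF x0 xS xE] by blast
    have "finite T" using T finite_E by (auto simp: spanning_trees_def intro: finite_subset)
    then have "exp (\<Sum>e\<in>E. w e * x e) \<le> (\<Prod>h\<in>T. exp (w h))"
      using T by (simp add: exp_sum[symmetric])
    also have "\<dots> \<le> Z w"
      unfolding Z_def using T(1) finite_spanning_trees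
      by (intro member_le_sum) (auto intro: prod_nonneg)
    finally show ?thesis .
  qed
  have Z_pos: "0 < Z w" for w using Z_ge[of w] less_le_trans[OF exp_gt_zero] by blast
  have "0 \<le> G w" for w
    using Z_ge[of w] Z_pos[of w] by (simp add: G_def ln_ge_iff)
  then have bdd: "bdd_below (range G)" by (intro bdd_belowI2)
  \<comment> \<open>The estimate below ends in \<open>t * r \<le> t * x e + 2 * t\<^sup>2\<close>,
    so \<open>2 * t\<close> has to equal \<open>\<delta>\<close>.\<close>
  define t where "t = \<delta> / 2"
  have t: "0 < t" using \<delta> by (simp add: t_def)
  obtain w where w: "G w < Inf (range G) + t\<^sup>2"
    using cInf_lessD[of "range G" "Inf (range G) + t\<^sup>2"] t by auto
  define c where "c e = exp (w e)" for e
  have "relative_resistance V E c e \<le> x e + \<delta>" if e: "e \<in> E" for e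
  proof -
    let ?r = "relative_resistance V E c e" and ?w = "w(e := w e - t)"
    have Zc: "(\<Sum>T\<in>spanning_trees V E. \<Prod>h\<in>T. c h) = Z w"
      by (simp add: Z_def c_def)
    have "exp (?w h) = (c(e := exp (- t) * c e)) h" for h
      by (simp add: c_def exp_diff exp_minus field_simps)
    then have "Z ?w = (\<Sum>T\<in>spanning_trees V E. \<Prod>h\<in>T. (c(e := exp (- t) * c e)) h)"
      by (simp only: Z_def)
    also have "\<dots> = Z w * (1 - (1 - exp (- t)) * ?r)"
      using tree_sum_scale_edge[of c e "exp (- t)"] Z_pos[of w] unfolding Zc by simp
    finally have Zw: "Z ?w = Z w * (1 - (1 - exp (- t)) * ?r)" .
    then have pos: "0 < 1 - (1 - exp (- t)) * ?r"
      using Z_pos[of ?w] Z_pos[of w] by (simp add: zero_less_mult_iff)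
    have r0: "0 \<le> ?r"
      unfolding relative_resistance_def c_def by (intro divide_nonneg_nonneg sum_nonneg prod_nonneg) auto
    \<comment> \<open>This crude bound absorbs the quadratic error
      \<open>t\<^sup>2 * ?r\<close>.\<close>
    have r1: "?r \<le> 1"
    proof -
      have "(\<Sum>T\<in>{T \<in> spanning_trees V E. e \<in> T}. \<Prod>h\<in>T. c h) \<le> Z w"
        unfolding Zc[symmetric] using finite_spanning_trees
        by (intro sum_mono2) (simp_all add: prod_nonneg c_def)
      then show ?thesis
        using Z_pos[of w] by (simp add: relative_resistance_def Zc)
    qed
    have "(\<Sum>h\<in>E. ?w h * x h) = (\<Sum>h\<in>E. w h * x h) - t * x e"
    proof -
      have "(\<Sum>h\<in>E - {e}. ?w h * x h) = (\<Sum>h\<in>E - {e}. w h * x h)"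
        by (intro sum.cong) auto
      then show ?thesis
        using e finite_E by (simp add: sum.remove[of E e] algebra_simps)
    qed
    moreover have "ln (Z ?w) = ln (Z w) + ln (1 - (1 - exp (- t)) * ?r)"
      unfolding Zw using Z_pos[of w] pos by (simp add: ln_mult)
    moreover have "ln (1 - (1 - exp (- t)) * ?r) \<le> - ((1 - exp (- t)) * ?r)"
      using ln_le_minus_one[OF pos] by simp
    moreover have "G w < G ?w + t\<^sup>2"
      using w cInf_lower[OF _ bdd, of "G ?w"] by fastforce
    ultimately have 1: "(1 - exp (- t)) * ?r \<le> t * x e + t\<^sup>2"
      by (simp add: G_def)
    \<comment> \<open>The aim is \<open>1 - exp (- t) \<ge> t - t\<^sup>2\<close>, to turn the exact
      gain into one linear in \<open>t\<close>.\<close>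
    have "(1 + t) * exp (- t) \<le> 1"
      using exp_ge_add_one_self[of t] by (simp add: exp_minus field_simps)
    then have "exp (- t) \<le> 1 / (1 + t)" using t by (simp add: field_simps)
    also have "\<dots> \<le> 1 - t + t\<^sup>2"
      using t by (simp add: field_simps power2_eq_square)
    finally have "(t - t\<^sup>2) * ?r \<le> (1 - exp (- t)) * ?r"
      using r0 by (intro mult_right_mono) auto
    with 1 have "t * ?r \<le> t * x e + t\<^sup>2 + t\<^sup>2 * ?r" by (simp add: algebra_simps)
    also have "\<dots> \<le> t * x e + t\<^sup>2 + t\<^sup>2 * 1"
      using r1 by (intro add_left_mono mult_left_mono) auto
    also have "\<dots> = t * (x e + \<delta>)"
      by (simp add: t_def power2_eq_square algebra_simps)
    finally show ?thesis using t by simp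
  qed
  then show ?thesis using that[of c] by (simp add: c_def)
qed

section \<open>Degrees of fractional Hamiltonian cycles and the conclusion\<close>

text \<open>Double counting: an edge inside \<open>S\<close> meets it in two vertices, a boundary
  edge in one.\<close>

lemma sum_degrees:
  fixes f :: "'a set \<Rightarrow> real"
  assumes "S \<subseteq> V"
  shows "(\<Sum>v\<in>S. \<Sum>e\<in>{e \<in> E. v \<in> e}. f e)
    = 2 * (\<Sum>e\<in>{e \<in> E. e \<subseteq> S}. f e) + (\<Sum>e\<in>edge_boundary E S. f e)"
proof -
  have finS: "finite S" using assms finite_V finite_subset by blast
  have card: "real (card (e \<inter> S)) = (if e \<subseteq> S then 2 else 0) + (if card (e \<inter> S) = 1 then 1 else 0)"
    if e: "e \<in> E" for e
  proof -
    obtain u v where "e = {u, v}" "u \<noteq> v"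
      using edges[OF e] by (auto simp: card_2_iff)
    then show ?thesis by (cases "u \<in> S"; cases "v \<in> S") auto
  qed
  have "(\<Sum>v\<in>S. \<Sum>e\<in>{e \<in> E. v \<in> e}. f e) = (\<Sum>e\<in>E. \<Sum>v\<in>{v \<in> S. v \<in> e}. f e)"
    using finS finite_E by (rule sum.swap_restrict)
  also have "\<dots> = (\<Sum>e\<in>E. real (card (e \<inter> S)) * f e)"
    by (simp add: Collect_conj_eq Int_commute)
  also have "\<dots> = (\<Sum>e\<in>E. 2 * (if e \<subseteq> S then f e else 0) + (if card (e \<inter> S) = 1 then f e else 0))"
    using card by (intro sum.cong) (auto simp: algebra_simps)
  also have "\<dots> = 2 * (\<Sum>e\<in>{e \<in> E. e \<subseteq> S}. f e) + (\<Sum>e\<in>edge_boundary E S. f e)"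
    using finite_E by (simp add: sum.distrib sum_distrib_left sum.inter_filter edge_boundary_def)
  finally show ?thesis .
qed

text \<open>The cuts around single vertices make all degrees at least 2, while the degrees add up to
  twice the total of \<open>f\<close>, that is \<open>2 * card V\<close>; so equality holds
  everywhere.\<close>

lemma fractional_hamiltonian_degree:
  assumes f: "fractional_hamiltonian_cycle V E f" and n: "card V \<ge> 2" and v: "v \<in> V"
  shows "(\<Sum>e\<in>{e \<in> E. v \<in> e}. f e) = 2"
proof -
  let ?d = "\<lambda>v. \<Sum>e\<in>{e \<in> E. v \<in> e}. f e"
  have ge: "2 \<le> ?d v" if "v \<in> V" for v
  proof -
    have "edge_boundary E {v} = {e \<in> E. v \<in> e}"
      by (auto simp: edge_boundary_def Int_insert_right)
    moreover have "{v} \<subset> V" using that n by auto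
    ultimately show ?thesis
      using f by (auto simp: fractional_hamiltonian_cycle_def)
  qed
  have "edge_boundary E V = {}" and "{e \<in> E. e \<subseteq> V} = E"
    using edges by (force simp: edge_boundary_def Int_absorb2)+
  then have "(\<Sum>v\<in>V. ?d v) = (\<Sum>v\<in>V. 2)"
    using sum_degrees[of V f] f by (simp add: fractional_hamiltonian_cycle_def)
  then show ?thesis
    using sum_mono_inv[of "\<lambda>_. 2" V ?d v] ge v finite_V by simp
qed

lemma fractional_hamiltonian_imp_resistance_positive:
  assumes "fractional_hamiltonian_cycle V E f"
  shows "resistance_positive V E"
proof -
  note f = assms[unfolded fractional_hamiltonian_cycle_def]
  have V0: "V \<noteq> {}" using connected by (simp add: connected_graph_def)
  \<comment> \<open>A single vertex carries no edge, so \<open>f\<close> would have total 0 instead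
    of 1.\<close>
  have n: "card V \<ge> 2"
  proof (rule ccontr)
    assume small: "\<not> 2 \<le> card V"
    have "E = {}"
    proof (rule ccontr)
      assume "E \<noteq> {}"
      then obtain e where "e \<subseteq> V" "card e = 2" using edges by blast
      then show False using small card_mono[OF finite_V, of e] by simp
    qed
    then show False using f V0 finite_V by simp
  qed
  define n where "n = real (card V)"
  have n2: "n \<ge> 2" using n by (simp add: n_def)
  \<comment> \<open>The factor lowers the total from \<open>n\<close> to \<open>n - 1\<close>, the
    number of edges of a spanning tree.\<close>
  define x where "x e = (n - 1) / n * f e" for e
  \<comment> \<open>The degrees in \<open>S\<close> add up to \<open>2 * card S\<close>; at least 2
    of this goes to the boundary, and half of the rest is the weight inside
    \<open>S\<close>.\<close>
  have fS: "(\<Sum>e\<in>{e \<in> E. e \<subseteq> S}. f e) \<le> real (card S) - 1" if "S \<noteq> {}" "S \<subset> V" for S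
  proof -
    have "(\<Sum>v\<in>S. \<Sum>e\<in>{e \<in> E. v \<in> e}. f e) = (\<Sum>v\<in>S. 2)"
      using that by (intro sum.cong fractional_hamiltonian_degree[OF assms n]) auto
    moreover have "2 \<le> (\<Sum>e\<in>edge_boundary E S. f e)" using f that by blast
    ultimately show ?thesis using sum_degrees[of S f] that by simp
  qed
  have xE: "(\<Sum>e\<in>E. x e) = real (card V) - 1"
  proof -
    have "(\<Sum>e\<in>E. x e) = (n - 1) / n * (\<Sum>e\<in>E. f e)"
      by (simp only: x_def sum_distrib_left)
    then show ?thesis using f n2 by (simp add: n_def)
  qed
  have x0: "0 \<le> x e" if "e \<in> E" for e
    using f that n2 by (simp add: x_def)
  have xS: "(\<Sum>e\<in>{e \<in> E. e \<subseteq> S}. x e) \<le> real (card S) - 1" if S: "S \<noteq> {}" "S \<subseteq> V" for S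
  proof (cases "S = V")
    case True
    moreover have "{e \<in> E. e \<subseteq> V} = E" using edges by auto
    ultimately show ?thesis using xE by simp
  next
    case False
    have "(\<Sum>e\<in>{e \<in> E. e \<subseteq> S}. x e) \<le> (\<Sum>e\<in>{e \<in> E. e \<subseteq> S}. f e)"
    proof (rule sum_mono)
      fix e assume "e \<in> {e \<in> E. e \<subseteq> S}"
      then have "0 \<le> f e" using f by blast
      then show "x e \<le> f e"
        unfolding x_def using n2 by (intro mult_left_le_one_le) auto
    qed
    also have "\<dots> \<le> real (card S) - 1" using fS S False by blast
    finally show ?thesis .
  qed
  \<comment> \<open>The degrees of \<open>x\<close> fall short of 2 by \<open>2 / n\<close>. The
    errors at one vertex add up to at most \<open>(card E + 1) * \<delta> = 1 / n\<close>, which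
    leaves positive curvature.\<close>
  define \<delta> where "\<delta> = 1 / (n * (real (card E) + 1))"
  have "0 < \<delta>" using n2 by (simp add: \<delta>_def add_nonneg_pos)
  then obtain c where c: "\<And>e. 0 < c e"
    and r: "\<And>e. e \<in> E \<Longrightarrow> relative_resistance V E c e \<le> x e + \<delta>"
    using relative_resistance_approx[of x \<delta>, OF x0 xS xE] by blast
  have "0 < resistance_curvature V E c v" if v: "v \<in> V" for v
  proof -
    let ?D = "{e \<in> E. v \<in> e}"
    have "(\<Sum>e\<in>?D. relative_resistance V E c e) \<le> (\<Sum>e\<in>?D. x e + \<delta>)"
      using r by (intro sum_mono) auto
    also have "\<dots> = (n - 1) / n * (\<Sum>e\<in>?D. f e) + real (card ?D) * \<delta>"
      by (simp only: sum.distrib x_def sum_distrib_left sum_constant)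
    also have "\<dots> = (n - 1) / n * 2 + real (card ?D) * \<delta>"
      using fractional_hamiltonian_degree[OF assms n v] by simp
    also have "\<dots> \<le> (n - 1) / n * 2 + (real (card E) + 1) * \<delta>"
      using card_mono[OF finite_E, of ?D] \<open>0 < \<delta>\<close>
      by (intro add_left_mono mult_right_mono) auto
    also have "(real (card E) + 1) * \<delta> = 1 / n"
    proof -
      have "real (card E) + 1 \<noteq> 0" by linarith
      then show ?thesis by (simp add: \<delta>_def)
    qed
    also have "(n - 1) / n * 2 + 1 / n < 2" using n2 by (simp add: field_simps)
    finally show ?thesis by (simp add: resistance_curvature_def)
  qed
  with c show ?thesis unfolding resistance_positive_def by blast
qed

end

theorem theorem4:
  fixes V :: "'a set" and E :: "'a set set"
  assumes "fin_simple_connected_graph V E"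
    and "fractionally_hamiltonian V E"
  shows "resistance_positive V E"
  using assms fin_simple_connected_graph.fractional_hamiltonian_imp_resistance_positive
  unfolding fractionally_hamiltonian_def by blast

end
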